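(* Let $k\ge1$ be an integer, $H\in\mathbb{F}_q[x]$, and let $D_1,D_2$ be monic polynomials with $D_1^k\mid H$ and $D_2^k\mid H$. Then $$\phi_k(D_2)\,\eta_k\!\left(\frac{H}{D_2^k},D_1\right)=\phi_k(D_1)\,\eta_k\!\left(\frac{H}{D_1^k},D_2\right).$$
   Context: Let $\mathbb{F}_q$ be a finite field with $q$ elements and fix a non-trivial homomorphism $\lambda:(\mathbb{F}_q,+)\to\mathbb{C}^*$. For nonzero $M\in\mathbb{F}_q[x]$ of degree $m\ge1$ and $A\in\mathbb{F}_q[x]$, let $t_M(A)$ be the coefficient of $x^{m-1}$ in the remainder of $A$ on division by $M$ (if $m=0$, $t_M(A)=0$), and $E(G,M)(A)=\lambda(t_M(GA))$. For $A,B$ not both zero, $(A,B)_k$ is the monic polynomial of the form $C^k$ of largest degree dividing both $A$ and $B$. For nonzero $D$, $\eta_k(G,D)=\sum_{R}E(G,D^k)(R)$, where $R$ runs over a complete residue system modulo $D^k$ with $(R,D^k)_k=1$. $|A|=q^{\deg A}$, and $\phi_k(D)=|D|^k\prod_{P}(1-|P|^{-k})$, the product over monic irreducible $P$ dividing $D$. *)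

theory Defs
  imports Complex_Main "HOL-Library.Cardinality"
    "HOL-Computational_Algebra.Polynomial"
begin

definition tcoeff :: "'a::field poly \<Rightarrow> 'a poly \<Rightarrow> 'a" where
  "tcoeff M A = (if degree M = 0 then 0 else coeff (A mod M) (degree M - 1))"

definition E_char :: "('a::field \<Rightarrow> complex) \<Rightarrow> 'a poly \<Rightarrow> 'a poly \<Rightarrow> 'a poly \<Rightarrow> complex" where
  "E_char lam G M A = lam (tcoeff M (G * A))"

definition is_kgcd :: "nat \<Rightarrow> 'a::field poly \<Rightarrow> 'a poly \<Rightarrow> 'a poly \<Rightarrow> bool" where
  "is_kgcd k A B G \<longleftrightarrow>
     is_arg_max degree
       (\<lambda>G. lead_coeff G = 1 \<and> (\<exists>C. G = C ^ k) \<and> G dvd A \<and> G dvd B) G"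

definition kgcd :: "nat \<Rightarrow> 'a::field poly \<Rightarrow> 'a poly \<Rightarrow> 'a poly" where
  "kgcd k A B = (THE G. is_kgcd k A B G)"

(* The sum runs over the reduced representatives modulo D ^ k. By eta_complete_residue_system
   below, any other complete residue system gives the same value. *)
definition eta :: "('a::field \<Rightarrow> complex) \<Rightarrow> nat \<Rightarrow> 'a poly \<Rightarrow> 'a poly \<Rightarrow> complex" where
  "eta lam k G D =
     (\<Sum>R | R mod D ^ k = R \<and> kgcd k R (D ^ k) = 1. E_char lam G (D ^ k) R)"

definition pnorm :: "'a::{field,finite} poly \<Rightarrow> real" where
  "pnorm A = (if A = 0 then 0 else real CARD('a) ^ degree A)"

definition phi :: "nat \<Rightarrow> 'a::{field,finite} poly \<Rightarrow> real" where
  "phi k D = pnorm D ^ k *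
     (\<Prod>P | irreducible P \<and> lead_coeff P = 1 \<and> P dvd D. 1 - 1 / pnorm P ^ k)"

definition complete_residue_system :: "'a::field poly \<Rightarrow> 'a poly set \<Rightarrow> bool" where
  "complete_residue_system M S \<longleftrightarrow> (\<forall>A. \<exists>!R. R \<in> S \<and> R mod M = A mod M)"

lemma kgcd_mod: "kgcd k (R mod M) M = kgcd k R M"
proof -
  have "G dvd R mod M \<and> G dvd M \<longleftrightarrow> G dvd R \<and> G dvd M" for G
    by (metis dvd_mod_iff)
  then show ?thesis by (simp add: kgcd_def is_kgcd_def)
qed

lemma E_char_mod: "E_char lam G M (R mod M) = E_char lam G M R"
  by (simp add: E_char_def tcoeff_def mod_mult_right_eq)

lemma eta_complete_residue_system:
  assumes S: "complete_residue_system (D ^ k) S"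
  shows "(\<Sum>R | R \<in> S \<and> kgcd k R (D ^ k) = 1. E_char lam G (D ^ k) R) = eta lam k G D"
proof -
  let ?M = "D ^ k"
  have "bij_betw (\<lambda>R. R mod ?M) {R. R \<in> S \<and> kgcd k R ?M = 1}
          {R. R mod ?M = R \<and> kgcd k R ?M = 1}"
  proof (rule bij_betwI')
    fix X Y assume "X \<in> {R. R \<in> S \<and> kgcd k R ?M = 1}" "Y \<in> {R. R \<in> S \<and> kgcd k R ?M = 1}"
    then show "X mod ?M = Y mod ?M \<longleftrightarrow> X = Y"
      using S unfolding complete_residue_system_def by blast
  next
    fix X assume "X \<in> {R. R \<in> S \<and> kgcd k R ?M = 1}"
    then show "X mod ?M \<in> {R. R mod ?M = R \<and> kgcd k R ?M = 1}"
      by (simp add: kgcd_mod)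
  next
    fix Y assume Y: "Y \<in> {R. R mod ?M = R \<and> kgcd k R ?M = 1}"
    obtain X where X: "X \<in> S" "X mod ?M = Y mod ?M"
      using S unfolding complete_residue_system_def by blast
    have "kgcd k X ?M = 1"
      using X Y kgcd_mod[of k X ?M] by simp
    with X Y show "\<exists>X\<in>{R. R \<in> S \<and> kgcd k R ?M = 1}. Y = X mod ?M"
      by auto
  qed
  then show ?thesis
    unfolding eta_def by (simp flip: sum.reindex_bij_betw add: E_char_mod)
qed

lemma kgcd_exists:
  fixes A B :: "'a::field poly"
  assumes "A \<noteq> 0 \<or> B \<noteq> 0"
  shows "\<exists>G. is_kgcd k A B G"
proof -
  let ?P = "\<lambda>G. lead_coeff G = 1 \<and> (\<exists>C. G = C ^ k) \<and> G dvd A \<and> G dvd B"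
  have P1: "?P 1" by (auto intro: exI[of _ 1])
  have "\<forall>G. ?P G \<longrightarrow> degree G < Suc (max (degree A) (degree B))"
    using assms by (auto dest!: dvd_imp_degree_le simp: less_Suc_eq_le)
  from ex_has_greatest_nat[OF P1 this] show ?thesis
    unfolding is_kgcd_def is_arg_max_linorder by blast
qed

lemma poly_bezout:
  fixes A B :: "'a::field poly"
  shows "\<exists>g u v. g dvd A \<and> g dvd B \<and> g = u * A + v * B"
proof (induction "euclidean_size B" arbitrary: A B rule: less_induct)
  case less
  show ?case
  proof (cases "B = 0")
    case True
    then show ?thesis by (intro exI[of _ A] exI[of _ 1]) auto
  next
    case False
    then have "euclidean_size (A mod B) < euclidean_size B" by (rule mod_size_less)
    from less[OF this, of B] obtain g u v
      where g: "g dvd B" "g dvd A mod B" "g = u * B + v * (A mod B)" by blast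
    have "g = v * A + (u - v * (A div B)) * B"
      using g(3) by (simp add: minus_div_mult_eq_mod[symmetric] algebra_simps)
    moreover have "g dvd A" using g(1,2) by (simp add: dvd_mod_iff)
    ultimately show ?thesis using g(1) by blast
  qed
qed

lemma comaximal_mult:
  fixes a b c :: "'a::comm_ring_1"
  assumes "\<exists>u v. u * a + v * b = 1" "\<exists>u v. u * a + v * c = 1"
  shows "\<exists>u v. u * a + v * (b * c) = 1"
proof -
  from assms obtain u v s t where *: "u * a + v * b = 1" "s * a + t * c = 1" by blast
  have "(u * s * a + u * t * c + v * b * s) * a + (v * t) * (b * c)
      = (u * a + v * b) * (s * a + t * c)"
    by (simp add: algebra_simps)
  with * show ?thesis by (metis mult_1)
qed

lemma comaximal_power:
  fixes a b :: "'a::comm_ring_1"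
  assumes "\<exists>u v. u * a + v * b = 1"
  shows "\<exists>u v. u * a + v * b ^ n = 1"
proof (induction n)
  case 0
  show ?case by (intro exI[of _ 0] exI[of _ 1]) simp
next
  case (Suc n)
  then show ?case using comaximal_mult[OF assms Suc] by simp
qed

lemma kth_power_lcm:
  fixes g a b A :: "'a::idom"
  assumes comax: "\<exists>u v. u * a + v * b = 1"
    and dvd: "(g * a) ^ k dvd A" "(g * b) ^ k dvd A"
  shows "(g * a * b) ^ k dvd A"
proof (cases "g = 0")
  case True
  with dvd show ?thesis by simp
next
  case False
  obtain X where X: "A = (g * a) ^ k * X" using dvd(1) by blast
  have "g ^ k * b ^ k dvd g ^ k * (a ^ k * X)"
    using dvd(2) X by (simp add: power_mult_distrib mult_ac)
  then have d: "b ^ k dvd a ^ k * X" using False by simp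
  have "\<exists>u v. u * a + v * b ^ k = 1" using comax by (rule comaximal_power)
  then have "\<exists>u v. u * b ^ k + v * a = 1" by (metis add.commute)
  then have "\<exists>u v. u * b ^ k + v * a ^ k = 1" by (rule comaximal_power)
  then obtain u v where uv: "u * b ^ k + v * a ^ k = 1" by blast
  have "X = (u * b ^ k + v * a ^ k) * X" using uv by simp
  also have "\<dots> = b ^ k * (u * X) + v * (a ^ k * X)" by (simp add: algebra_simps)
  finally have "b ^ k dvd X" using d by (metis dvd_add dvd_mult dvd_triv_left)
  then show ?thesis using X by (simp add: power_mult_distrib mult_dvd_mono)
qed

lemma kgcd_unique:
  fixes A B :: "'a::field poly"
  assumes k: "k \<ge> 1" and G: "is_kgcd k A B G" and G': "is_kgcd k A B G'"
  shows "G = G'"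
proof -
  let ?P = "\<lambda>G. lead_coeff G = 1 \<and> (\<exists>C. G = C ^ k) \<and> G dvd A \<and> G dvd B"
  from G obtain C where C: "G = C ^ k" "?P G" and maxG: "\<And>F. ?P F \<Longrightarrow> degree F \<le> degree G"
    unfolding is_kgcd_def is_arg_max_linorder by blast
  from G' obtain C' where C': "G' = C' ^ k" "?P G'" and maxG': "\<And>F. ?P F \<Longrightarrow> degree F \<le> degree G'"
    unfolding is_kgcd_def is_arg_max_linorder by blast
  have "C \<noteq> 0" "C' \<noteq> 0" using C C' k by (auto simp: zero_power)
  obtain g u v where g: "g dvd C" "g dvd C'" "g = u * C + v * C'"
    using poly_bezout by blast
  obtain a b where ab: "C = g * a" "C' = g * b" using g(1,2) unfolding dvd_def by blast
  have nz: "g \<noteq> 0" "a \<noteq> 0" "b \<noteq> 0" using ab \<open>C \<noteq> 0\<close> \<open>C' \<noteq> 0\<close> by auto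
  have "g * (u * a + v * b) = g * 1" using g(3) ab by (simp add: algebra_simps)
  then have comax: "\<exists>u v. u * a + v * b = 1" using nz by (metis mult_left_cancel)
  define L where "L = g * a * b"
  have "L \<noteq> 0" using nz by (simp add: L_def)
  define c where "c = inverse (lead_coeff L)"
  have c: "c \<noteq> 0" using \<open>L \<noteq> 0\<close> by (simp add: c_def)
  have "L ^ k dvd A" "L ^ k dvd B"
    unfolding L_def using C C' ab by (simp_all add: kth_power_lcm[OF comax])
  then have "(smult c L) ^ k dvd A" "(smult c L) ^ k dvd B"
    using c by (simp_all add: smult_power smult_dvd_iff)
  moreover have "lead_coeff ((smult c L) ^ k) = 1"
    using \<open>L \<noteq> 0\<close> by (simp only: lead_coeff_power lead_coeff_smult c_def) simp
  ultimately have P: "?P ((smult c L) ^ k)" by blast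
  have degL: "degree ((smult c L) ^ k) = k * (degree g + degree a + degree b)"
    using c nz by (simp add: degree_power_eq L_def degree_mult_eq)
  have "degree G = k * (degree g + degree a)" "degree G' = k * (degree g + degree b)"
    using C(1) C'(1) ab nz by (simp_all add: degree_power_eq degree_mult_eq)
  with maxG[OF P] maxG'[OF P] degL k have "degree a = 0" "degree b = 0"
    by auto
  then obtain x y where xy: "a = [:x:]" "b = [:y:]" by (auto elim!: degree_eq_zeroE)
  have "G = smult (x ^ k) (g ^ k)" "G' = smult (y ^ k) (g ^ k)"
    using C(1) C'(1) ab xy by (simp_all add: smult_power)
  moreover from this C(2) C'(2) have "x ^ k * lead_coeff (g ^ k) = y ^ k * lead_coeff (g ^ k)"
    by (metis lead_coeff_smult)
  moreover have "lead_coeff (g ^ k) \<noteq> 0" using nz by simp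
  ultimately show ?thesis by auto
qed

lemma is_kgcd_kgcd:
  assumes "k \<ge> 1" "A \<noteq> 0 \<or> B \<noteq> 0"
  shows "is_kgcd k A B (kgcd k A B)"
  unfolding kgcd_def
proof (rule theI')
  show "\<exists>!G. is_kgcd k A B G"
    using kgcd_exists[OF assms(2)] kgcd_unique[OF assms(1)] by blast
qed

end

theory Submission
  imports Defs "HOL-Computational_Algebra.Polynomial_Factorial"
begin

text \<open>
  Let \<open>N\<close> be the monic gcd of \<open>D1\<close> and \<open>D2\<close>, and write \<open>D1 = A N\<close>, \<open>D2 = B N\<close>; then \<open>(A B N)^k\<close>
  divides \<open>H\<close>. If \<open>G = A^k G'\<close>, the character \<open>E(G, (A N)^k)\<close> equals \<open>E(G', N^k)\<close>, and reduction
  modulo \<open>N^k\<close> maps the \<open>k\<close>-reduced residues modulo \<open>(A N)^k\<close> onto those modulo \<open>N^k\<close> with all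
  fibres of size \<open>\<phi>_k(A N) / \<phi>_k(N)\<close>. Hence \<open>\<phi>_k(N) \<eta>_k(G, A N) = \<phi>_k(A N) \<eta>_k(G', N)\<close>. For
  \<open>G = H / D2^k\<close> on \<open>D1\<close> and for \<open>G = H / D1^k\<close> on \<open>D2\<close> the reduced argument \<open>G'\<close> is the same, namely
  \<open>H / (A B N)^k\<close>, so both sides of the claim multiplied by \<open>\<phi>_k(N)\<close> agree. The fibres are
  counted by enlarging the modulus by one irreducible factor at a time.
\<close>

section \<open>Comaximal elements\<close>

definition comaximal :: "'a::comm_ring_1 \<Rightarrow> 'a \<Rightarrow> bool" where
  "comaximal a b \<longleftrightarrow> (\<exists>u v. u * a + v * b = 1)"

lemma comaximal_commute: "comaximal a b \<longleftrightarrow> comaximal b a"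
  unfolding comaximal_def by (metis add.commute)

lemma comaximal_powers:
  assumes "comaximal a b"
  shows "comaximal (a ^ m) (b ^ n)"
proof -
  have "comaximal x (y ^ n)" if "comaximal x y" for x y :: 'a and n
    using that unfolding comaximal_def by (rule comaximal_power)
  then show ?thesis using assms comaximal_commute by blast
qed

lemma dvd_add_mult_iff_of_bezout:
  fixes a m :: "'a::comm_ring_1"
  assumes bezout: "u * a + v * m = 1"
  shows "m dvd s + a * t \<longleftrightarrow> m dvd t + u * s"
proof
  assume "m dvd s + a * t"
  then have "m dvd u * (s + a * t) + m * (v * t)" by simp
  also have "u * (s + a * t) + m * (v * t) = (u * a + v * m) * t + u * s"
    by (simp add: algebra_simps)
  finally show "m dvd t + u * s" using bezout by simp
next
  assume "m dvd t + u * s"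
  then have "m dvd a * (t + u * s) + m * (v * s)" by simp
  also have "a * (t + u * s) + m * (v * s) = (u * a + v * m) * s + a * t"
    by (simp add: algebra_simps)
  finally show "m dvd s + a * t" using bezout by simp
qed

lemma coprime_poly_imp_comaximal:
  fixes A B :: "'a::field poly"
  assumes "coprime A B"
  shows "comaximal A B"
proof -
  obtain g u v where g: "g dvd A" "g dvd B" "g = u * A + v * B"
    using poly_bezout by blast
  then have "is_unit g" using assms by (blast intro: coprime_common_divisor)
  then obtain w where "1 = g * w" by (rule dvdE)
  then have "(w * u) * A + (w * v) * B = 1" using g(3) by (simp add: algebra_simps)
  then show ?thesis unfolding comaximal_def by blast
qed

lemma irreducible_poly_comaximal:
  fixes P M :: "'a::field poly"
  assumes "irreducible P" "\<not> P dvd M"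
  shows "comaximal P M"
proof (intro coprime_poly_imp_comaximal coprimeI)
  fix C assume "C dvd P" "C dvd M"
  then show "is_unit C" using assms irreducibleD'[of P C] dvd_trans by blast
qed

lemma monic_comaximal_cofactors:
  fixes D1 D2 :: "'a::field poly"
  assumes monic: "lead_coeff D1 = 1" "lead_coeff D2 = 1"
  obtains N A B where "D1 = A * N" "D2 = B * N"
    "lead_coeff N = 1" "lead_coeff A = 1" "lead_coeff B = 1" "comaximal A B"
proof -
  obtain g u v where g: "g dvd D1" "g dvd D2" "g = u * D1 + v * D2"
    using poly_bezout by blast
  define c where "c = inverse (lead_coeff g)"
  define N where "N = smult c g"
  have "g \<noteq> 0" using g(1) monic by auto
  then have N: "lead_coeff N = 1" "N \<noteq> 0" "N dvd D1" "N dvd D2"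
    using g(1,2) by (simp_all add: N_def c_def smult_dvd_iff)
  then obtain A B where AB: "D1 = A * N" "D2 = B * N" by (metis dvdE mult.commute)
  have "N = smult c u * D1 + smult c v * D2"
    by (simp add: N_def g(3) smult_add_right)
  then have "(smult c u * A + smult c v * B) * N = 1 * N"
    unfolding AB by (simp add: algebra_simps)
  then have "comaximal A B" using N(2) mult_right_cancel unfolding comaximal_def by blast
  moreover have "lead_coeff A = 1" "lead_coeff B = 1"
    using AB monic N(1) by (simp_all add: lead_coeff_mult)
  ultimately show ?thesis using that AB N(1) by blast
qed

section \<open>Monic irreducible divisors\<close>

lemma irreducible_poly_degree_pos:
  fixes P :: "'a::field poly"
  assumes "irreducible P"
  shows "degree P > 0"
  using assms is_unit_iff_degree[of P] by (auto simp: irreducible_altdef)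

lemma exists_monic_irreducible_dvd:
  fixes A :: "'a::field poly"
  assumes "degree A > 0"
  shows "\<exists>P. irreducible P \<and> lead_coeff P = 1 \<and> P dvd A"
  using assms
proof (induction "degree A" arbitrary: A rule: less_induct)
  case less
  then have A: "A \<noteq> 0" "\<not> is_unit A" by (auto elim!: is_unit_polyE)
  show ?case
  proof (cases "irreducible A")
    case True
    let ?c = "inverse (lead_coeff A)"
    have "irreducible ([:?c:] * A)"
      using True A(1) by (subst irreducible_mult_unit_left) (simp_all add: is_unit_pCons_iff)
    then show ?thesis
      using A(1) by (intro exI[of _ "smult ?c A"]) (simp add: smult_dvd_iff)
  next
    case False
    then obtain B where B: "B dvd A" "\<not> A dvd B" "\<not> is_unit B"
      using A unfolding irreducible_altdef by blast
    then obtain C where C: "A = B * C" by blast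
    then have "\<not> is_unit C" using B(2) by (auto simp: mult_unit_dvd_iff)
    then have "degree B > 0" "degree B < degree A"
      using A(1) B(3) C is_unit_iff_degree[of B] is_unit_iff_degree[of C]
      by (auto simp: degree_mult_eq)
    then show ?thesis using less.hyps B(1) dvd_trans by blast
  qed
qed

lemma poly_irreducible_induct [consumes 1, case_names unit mult]:
  fixes A :: "'a::field poly"
  assumes "A \<noteq> 0"
    and unit: "\<And>U. is_unit U \<Longrightarrow> Q U"
    and mult: "\<And>P B. irreducible P \<Longrightarrow> lead_coeff P = 1 \<Longrightarrow> B \<noteq> 0 \<Longrightarrow> Q B \<Longrightarrow> Q (P * B)"
  shows "Q A"
  using \<open>A \<noteq> 0\<close>
proof (induction "degree A" arbitrary: A rule: less_induct)
  case less
  show ?case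
  proof (cases "degree A = 0")
    case True
    then show ?thesis using less.prems unit is_unit_iff_degree by blast
  next
    case False
    then obtain P where P: "irreducible P" "lead_coeff P = 1" "P dvd A"
      using exists_monic_irreducible_dvd by blast
    then obtain B where B: "A = P * B" by blast
    then have "P \<noteq> 0" "B \<noteq> 0" using less.prems by auto
    then have "degree B < degree A"
      using B irreducible_poly_degree_pos[OF P(1)] by (simp add: degree_mult_eq)
    then show ?thesis using mult[OF P(1,2)] less.hyps \<open>B \<noteq> 0\<close> B by blast
  qed
qed

definition monic_irreducible_divisors :: "'a::field poly \<Rightarrow> 'a poly set" where
  "monic_irreducible_divisors D = {P. irreducible P \<and> lead_coeff P = 1 \<and> P dvd D}"

lemma monic_irreducible_divisors_mult:
  fixes P M :: "'a::field poly"
  assumes monic_irreducible: "irreducible P" "lead_coeff P = 1"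
  shows "monic_irreducible_divisors (P * M) = insert P (monic_irreducible_divisors M)"
proof -
  have "Q dvd P \<longleftrightarrow> Q = P" if Q_monic_irreducible: "irreducible Q" "lead_coeff Q = 1" for Q
  proof
    assume "Q dvd P"
    then obtain U where U: "P = Q * U" by blast
    then have "is_unit U"
      using irreducibleD[OF monic_irreducible(1)] irreducible_not_unit[OF Q_monic_irreducible(1)]
      by blast
    then have "U = 1"
      using U monic_irreducible(2) Q_monic_irreducible(2)
      by (auto simp: lead_coeff_mult elim!: is_unit_polyE)
    then show "Q = P" using U by simp
  qed simp
  then have "Q dvd P * M \<longleftrightarrow> Q = P \<or> Q dvd M" if "irreducible Q" "lead_coeff Q = 1" for Q
    using that by (simp add: prime_elem_dvd_mult_iff field_poly_irreducible_imp_prime)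
  then show ?thesis using monic_irreducible unfolding monic_irreducible_divisors_def by blast
qed

lemma finite_monic_irreducible_divisors:
  fixes D :: "'a::field poly"
  assumes "D \<noteq> 0"
  shows "finite (monic_irreducible_divisors D)"
  using assms
proof (induction D rule: poly_irreducible_induct)
  case (unit U)
  then have "monic_irreducible_divisors U = {}"
    unfolding monic_irreducible_divisors_def by (auto dest: dvd_unit_imp_unit irreducible_not_unit)
  then show ?case by simp
next
  case (mult P B)
  then show ?case by (simp add: monic_irreducible_divisors_mult)
qed

section \<open>Reduced residues modulo a polynomial\<close>

definition residues :: "'a::field poly \<Rightarrow> 'a poly set" where
  "residues M = {R. R mod M = R}"

lemma residues_iff_coeff:
  fixes M :: "'a::field poly"
  assumes "M \<noteq> 0"
  shows "R \<in> residues M \<longleftrightarrow> (\<forall>i\<ge>degree M. coeff R i = 0)"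
proof
  assume "R \<in> residues M"
  then show "\<forall>i\<ge>degree M. coeff R i = 0"
    using degree_mod_less[OF assms, of R] by (auto simp: residues_def intro: coeff_eq_0)
next
  assume vanish: "\<forall>i\<ge>degree M. coeff R i = 0"
  then have "R = 0 \<or> degree R < degree M" by (metis leading_coeff_0_iff linorder_not_less)
  then show "R \<in> residues M" by (auto simp: residues_def mod_poly_less)
qed

lemma bij_betw_Poly_residues:
  fixes M :: "'a::field poly"
  assumes "M \<noteq> 0"
  shows "bij_betw Poly {xs. length xs = degree M} (residues M)"
proof (rule bij_betw_byWitness[where f' = "\<lambda>R. map (coeff R) [0..<degree M]"])
  show "\<forall>xs\<in>{xs. length xs = degree M}. map (coeff (Poly xs)) [0..<degree M] = xs"
    by (auto intro!: nth_equalityI simp: coeff_Poly_eq nth_default_nth)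
  show "\<forall>R\<in>residues M. Poly (map (coeff R) [0..<degree M]) = R"
    by (auto simp: poly_eq_iff coeff_Poly_eq nth_default_def residues_iff_coeff[OF assms])
qed (auto simp: coeff_Poly_eq nth_default_beyond residues_iff_coeff[OF assms])

lemma
  fixes M :: "'a::{field,finite} poly"
  assumes "M \<noteq> 0"
  shows finite_residues: "finite (residues M)"
    and card_residues: "card (residues M) = CARD('a) ^ degree M"
  using bij_betw_finite[OF bij_betw_Poly_residues[OF assms]]
    bij_betw_same_card[OF bij_betw_Poly_residues[OF assms]]
    finite_lists_length_eq[of "UNIV :: 'a set" "degree M"]
    card_lists_length_eq[of "UNIV :: 'a set" "degree M"]
  by simp_all

lemma residues_mult_iff:
  fixes M Q :: "'a::field poly"
  assumes "M \<noteq> 0"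
  shows "R \<in> residues (M * Q) \<longleftrightarrow> R div M \<in> residues Q"
proof -
  have "R mod (M * Q) = M * (R div M mod Q) + R mod M"
    by (rule poly_mod_mult_right)
  moreover have "R = M * (R div M) + R mod M" by simp
  ultimately have "R mod (M * Q) = R \<longleftrightarrow> M * (R div M mod Q) = M * (R div M)"
    by (metis add_right_cancel)
  then show ?thesis using assms by (simp add: residues_def)
qed

lemma residues_mult_fibre:
  fixes M Q :: "'a::field poly"
  assumes M_nonzero: "M \<noteq> 0" and S_residue: "S \<in> residues M"
  shows "{R \<in> residues (M * Q). R mod M = S} = (\<lambda>T. S + M * T) ` residues Q"
proof (intro equalityI subsetI)
  fix R assume "R \<in> {R \<in> residues (M * Q). R mod M = S}"
  then have "R = S + M * (R div M)" "R div M \<in> residues Q"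
    using residues_mult_iff[OF M_nonzero] by auto
  then show "R \<in> (\<lambda>T. S + M * T) ` residues Q" by blast
next
  fix R assume "R \<in> (\<lambda>T. S + M * T) ` residues Q"
  then obtain T where T: "T \<in> residues Q" "R = S + M * T" by blast
  have S_mod: "S mod M = S" using S_residue by (simp add: residues_def)
  then have "S div M = 0" using M_nonzero by (simp add: mod_eq_self_iff_div_eq_0)
  then show "R \<in> {R \<in> residues (M * Q). R mod M = S}"
    using T M_nonzero S_mod by (simp add: residues_mult_iff)
qed

lemma residues_linear_congruence_singleton:
  fixes a m :: "'a::field poly"
  assumes "comaximal a m"
  shows "\<exists>T0. {T \<in> residues m. m dvd s + a * T} = {T0}"
proof -
  obtain u v where bezout: "u * a + v * m = 1"
    using assms unfolding comaximal_def by blast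
  define T0 where "T0 = (- (u * s)) mod m"
  have "m dvd s + a * T \<longleftrightarrow> T mod m = T0" for T
    by (simp only: T0_def mod_eq_dvd_iff diff_minus_eq_add dvd_add_mult_iff_of_bezout[OF bezout])
  moreover have "T0 mod m = T0" by (simp add: T0_def)
  ultimately have "{T \<in> residues m. m dvd s + a * T} = {T0}"
    by (auto simp: residues_def)
  then show ?thesis by blast
qed

section \<open>\<open>k\<close>-reduced residues\<close>

definition kcoprime :: "nat \<Rightarrow> 'a::field poly \<Rightarrow> 'a poly \<Rightarrow> bool" where
  "kcoprime k D R \<longleftrightarrow> (\<forall>P\<in>monic_irreducible_divisors D. \<not> P ^ k dvd R)"

lemma kgcd_eq_1_iff:
  fixes A B :: "'a::field poly"
  assumes k: "k \<ge> 1" and nonzero: "A \<noteq> 0 \<or> B \<noteq> 0"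
  shows "kgcd k A B = 1 \<longleftrightarrow> (\<forall>C. C ^ k dvd A \<and> C ^ k dvd B \<longrightarrow> is_unit C)"
proof -
  let ?P = "\<lambda>G. lead_coeff G = 1 \<and> (\<exists>C. G = C ^ k) \<and> G dvd A \<and> G dvd B"
  have "kgcd k A B = 1 \<longleftrightarrow> is_kgcd k A B 1"
    using is_kgcd_kgcd[OF k nonzero] kgcd_unique[OF k] by metis
  also have "\<dots> \<longleftrightarrow> (\<forall>G. ?P G \<longrightarrow> degree G = 0)"
    unfolding is_kgcd_def is_arg_max_linorder by (auto intro: exI[of _ 1])
  also have "\<dots> \<longleftrightarrow> (\<forall>C. C ^ k dvd A \<and> C ^ k dvd B \<longrightarrow> is_unit C)"
  proof (intro iffI allI impI)
    fix C assume deg: "\<forall>G. ?P G \<longrightarrow> degree G = 0" and C: "C ^ k dvd A \<and> C ^ k dvd B"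
    then have "C \<noteq> 0" using nonzero k by (auto simp: zero_power)
    define C' where "C' = smult (inverse (lead_coeff C)) C"
    have "lead_coeff C' = 1" using \<open>C \<noteq> 0\<close> by (simp add: C'_def)
    moreover have "C' ^ k dvd A" "C' ^ k dvd B"
      using C \<open>C \<noteq> 0\<close> by (simp_all add: C'_def smult_power smult_dvd_iff)
    ultimately have "?P (C' ^ k)" by (auto simp: lead_coeff_power)
    with deg have "degree (C' ^ k) = 0" by blast
    then have "degree C = 0"
      using k \<open>C \<noteq> 0\<close> by (simp add: C'_def degree_power_eq)
    then show "is_unit C" using \<open>C \<noteq> 0\<close> is_unit_iff_degree by blast
  next
    fix G assume "\<forall>C. C ^ k dvd A \<and> C ^ k dvd B \<longrightarrow> is_unit C" and "?P G"
    then have "is_unit G" by (metis is_unit_power_iff)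
    then show "degree G = 0" by (auto elim!: is_unit_polyE)
  qed
  finally show ?thesis .
qed

lemma kgcd_eq_1_iff_kcoprime:
  fixes D :: "'a::field poly"
  assumes k: "k \<ge> 1" and D_nonzero: "D \<noteq> 0"
  shows "kgcd k R (D ^ k) = 1 \<longleftrightarrow> kcoprime k D R"
proof -
  have "kgcd k R (D ^ k) = 1 \<longleftrightarrow> (\<forall>C. C ^ k dvd R \<and> C ^ k dvd D ^ k \<longrightarrow> is_unit C)"
    using D_nonzero by (intro kgcd_eq_1_iff[OF k]) simp
  also have "\<dots> \<longleftrightarrow> kcoprime k D R"
  proof
    assume "\<forall>C. C ^ k dvd R \<and> C ^ k dvd D ^ k \<longrightarrow> is_unit C"
    then show "kcoprime k D R"
      unfolding kcoprime_def monic_irreducible_divisors_def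
      by (blast intro: dvd_power_same dest: irreducible_not_unit)
  next
    assume coprime: "kcoprime k D R"
    show "\<forall>C. C ^ k dvd R \<and> C ^ k dvd D ^ k \<longrightarrow> is_unit C"
    proof (intro allI impI, rule ccontr)
      fix C assume C: "C ^ k dvd R \<and> C ^ k dvd D ^ k" and "\<not> is_unit C"
      moreover have "C \<noteq> 0" using C D_nonzero k by (auto simp: zero_power)
      ultimately have "degree C > 0" using is_unit_iff_degree by blast
      then obtain P where P: "irreducible P" "lead_coeff P = 1" "P dvd C"
        using exists_monic_irreducible_dvd by blast
      have kth_power_dvd: "P ^ k dvd R" "P ^ k dvd D ^ k"
        using P(3) C by (meson dvd_power_same dvd_trans)+
      then have "P dvd D ^ k" using k by (meson dvd_power dvd_trans less_le_trans zero_less_one)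
      then have "P dvd D"
        using P(1) field_poly_irreducible_imp_prime prime_elem_dvd_power by blast
      then show False
        using coprime P kth_power_dvd(1) unfolding kcoprime_def monic_irreducible_divisors_def by blast
    qed
  qed
  finally show ?thesis .
qed

lemma kcoprime_add_mult: "kcoprime k D (S + D ^ k * T) \<longleftrightarrow> kcoprime k D S"
proof -
  have "P ^ k dvd S + D ^ k * T \<longleftrightarrow> P ^ k dvd S" if "P dvd D" for P
    using that by (meson dvd_add_left_iff dvd_mult2 dvd_power_same)
  then show ?thesis unfolding kcoprime_def monic_irreducible_divisors_def by blast
qed

lemma kcoprime_mod: "kcoprime k D (R mod D ^ k) \<longleftrightarrow> kcoprime k D R"
  using kcoprime_add_mult[of k D "R mod D ^ k" "R div D ^ k"] by simp

lemma kcoprime_irreducible_mult: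
  fixes P M :: "'a::field poly"
  assumes "irreducible P" "lead_coeff P = 1"
  shows "kcoprime k (P * M) R \<longleftrightarrow> kcoprime k M R \<and> \<not> P ^ k dvd R"
  unfolding kcoprime_def monic_irreducible_divisors_mult[OF assms] by blast

definition kred_residues :: "nat \<Rightarrow> 'a::field poly \<Rightarrow> 'a poly set" where
  "kred_residues k D = {R \<in> residues (D ^ k). kcoprime k D R}"

lemma eta_eq_sum_kred_residues:
  assumes "k \<ge> 1" "D \<noteq> 0"
  shows "eta lam k G D = sum (E_char lam G (D ^ k)) (kred_residues k D)"
  by (simp add: eta_def kred_residues_def residues_def kgcd_eq_1_iff_kcoprime[OF assms])

lemma finite_kred_residues:
  fixes D :: "'a::{field,finite} poly"
  assumes "D \<noteq> 0"
  shows "finite (kred_residues k D)"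
  using finite_residues[of "D ^ k"] assms by (simp add: kred_residues_def)

lemma card_residues_dvd_lift:
  fixes P M :: "'a::field poly"
  assumes monic_irreducible: "irreducible P" "lead_coeff P = 1" and S_kcoprime: "kcoprime k M S"
  shows "card {T \<in> residues (P ^ k). P ^ k dvd S + M ^ k * T} = of_bool (\<not> P dvd M)"
proof (cases "P dvd M")
  case True
  then have "P \<in> monic_irreducible_divisors M"
    using monic_irreducible by (simp add: monic_irreducible_divisors_def)
  then have "\<not> P ^ k dvd S + M ^ k * T" for T
    using S_kcoprime kcoprime_add_mult[of k M S T] unfolding kcoprime_def by blast
  then show ?thesis using True by simp
next
  case False
  have "comaximal (M ^ k) (P ^ k)"
    using irreducible_poly_comaximal[OF monic_irreducible(1) False]
    by (intro comaximal_powers) (simp add: comaximal_commute)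
  then obtain T0 where "{T \<in> residues (P ^ k). P ^ k dvd S + M ^ k * T} = {T0}"
    using residues_linear_congruence_singleton by blast
  then show ?thesis using False by simp
qed

definition kred_fibre_size :: "nat \<Rightarrow> 'a::{field,finite} poly \<Rightarrow> 'a poly \<Rightarrow> nat" where
  "kred_fibre_size k P M = CARD('a) ^ degree (P ^ k) - of_bool (\<not> P dvd M)"

lemma card_kred_residues_fibre:
  fixes P M :: "'a::{field,finite} poly"
  assumes monic_irreducible: "irreducible P" "lead_coeff P = 1" and M_nonzero: "M \<noteq> 0"
    and S_kred: "S \<in> kred_residues k M"
  shows "card {R \<in> kred_residues k (P * M). R mod M ^ k = S} = kred_fibre_size k P M"
proof -
  let ?lift = "\<lambda>T. S + M ^ k * T"
  let ?bad = "{T \<in> residues (P ^ k). P ^ k dvd ?lift T}"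
  have nonzero: "P ^ k \<noteq> 0" "M ^ k \<noteq> 0" using monic_irreducible M_nonzero by auto
  have S_residue: "S \<in> residues (M ^ k)" "kcoprime k M S"
    using S_kred by (simp_all add: kred_residues_def)
  have "{R \<in> kred_residues k (P * M). R mod M ^ k = S}
      = {R \<in> {R \<in> residues (M ^ k * P ^ k). R mod M ^ k = S}. kcoprime k (P * M) R}"
    by (auto simp: kred_residues_def power_mult_distrib mult.commute)
  also have "\<dots> = ?lift ` (residues (P ^ k) - ?bad)"
    unfolding residues_mult_fibre[OF nonzero(2) S_residue(1)]
    using S_residue(2)
    by (auto simp: kcoprime_irreducible_mult[OF monic_irreducible] kcoprime_add_mult)
  also have "card \<dots> = card (residues (P ^ k) - ?bad)"
    using nonzero by (intro card_image) (simp add: inj_on_def)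
  also have "\<dots> = card (residues (P ^ k)) - card ?bad"
    using finite_residues[OF nonzero(1)] by (intro card_Diff_subset) auto
  finally show ?thesis
    unfolding kred_fibre_size_def card_residues[OF nonzero(1)]
      card_residues_dvd_lift[OF monic_irreducible S_residue(2)] .
qed

lemma sum_kred_residues_irreducible_mult:
  fixes P M :: "'a::{field,finite} poly" and f :: "'a poly \<Rightarrow> 'b::real_vector"
  assumes monic_irreducible: "irreducible P" "lead_coeff P = 1" and M_nonzero: "M \<noteq> 0"
    and periodic: "\<And>R. f (R mod M ^ k) = f R"
  shows "sum f (kred_residues k (P * M))
       = real (kred_fibre_size k P M) *\<^sub>R sum f (kred_residues k M)"
proof -
  let ?fibre = "\<lambda>S. {R \<in> kred_residues k (P * M). R mod M ^ k = S}"
  have "P * M \<noteq> 0" using monic_irreducible M_nonzero by auto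
  note finite_kred = finite_kred_residues[OF this, of k] finite_kred_residues[OF M_nonzero, of k]
  have "(\<lambda>R. R mod M ^ k) ` kred_residues k (P * M) \<subseteq> kred_residues k M"
    by (auto simp: kred_residues_def residues_def kcoprime_mod
        kcoprime_irreducible_mult[OF monic_irreducible])
  from sum.group[OF finite_kred this, of f]
  have "sum f (kred_residues k (P * M)) = (\<Sum>S\<in>kred_residues k M. sum f (?fibre S))"
    by (rule sym)
  also have "\<dots> = (\<Sum>S\<in>kred_residues k M. \<Sum>R\<in>?fibre S. f S)"
    using periodic by (intro sum.cong refl) auto
  also have "\<dots> = (\<Sum>S\<in>kred_residues k M. real (kred_fibre_size k P M) *\<^sub>R f S)"
    by (intro sum.cong refl)
      (simp only: sum_constant_scaleR card_kred_residues_fibre[OF monic_irreducible M_nonzero])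
  finally show ?thesis by (simp only: scaleR_sum_right)
qed

section \<open>Jordan's totient\<close>

lemma pnorm_mult: "pnorm (A * B) = pnorm A * pnorm B"
  by (simp add: pnorm_def degree_mult_eq power_add)

lemma pnorm_power: "pnorm (A ^ n) = pnorm A ^ n"
  by (induction n) (simp_all add: pnorm_mult, simp add: pnorm_def)

lemma pnorm_irreducible_gt_1:
  fixes P :: "'a::{field,finite} poly"
  assumes "irreducible P"
  shows "pnorm P > 1"
proof -
  have "card {0, 1 :: 'a} \<le> CARD('a)" by (intro card_mono) auto
  then have "real CARD('a) > 1" by simp
  then show ?thesis
    using assms irreducible_poly_degree_pos[OF assms] by (auto simp: pnorm_def one_less_power)
qed

lemma phi_eq_prod_monic_irreducible_divisors:
  "phi k D = pnorm D ^ k * (\<Prod>P\<in>monic_irreducible_divisors D. 1 - 1 / pnorm P ^ k)"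
  by (simp add: phi_def monic_irreducible_divisors_def)

lemma phi_nonzero:
  fixes D :: "'a::{field,finite} poly"
  assumes "k \<ge> 1" "D \<noteq> 0"
  shows "phi k D \<noteq> 0"
proof -
  have "1 - 1 / pnorm P ^ k \<noteq> 0" if "P \<in> monic_irreducible_divisors D" for P
  proof -
    have "pnorm P > 1"
      using that by (simp add: monic_irreducible_divisors_def pnorm_irreducible_gt_1)
    then have "pnorm P ^ k > 1" using assms(1) by (intro one_less_power) auto
    then show ?thesis by simp
  qed
  then show ?thesis
    using assms finite_monic_irreducible_divisors[OF assms(2)]
    by (simp add: phi_eq_prod_monic_irreducible_divisors pnorm_def)
qed

lemma phi_irreducible_mult:
  fixes P M :: "'a::{field,finite} poly"
  assumes monic_irreducible: "irreducible P" "lead_coeff P = 1" and M_nonzero: "M \<noteq> 0"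
  shows "phi k (P * M) = real (kred_fibre_size k P M) * phi k M"
proof -
  let ?I = monic_irreducible_divisors
  have "P \<noteq> 0" using monic_irreducible by auto
  then have "pnorm P > 0" by (simp add: pnorm_def)
  have "real (CARD('a) ^ degree (P ^ k)) = pnorm P ^ k"
    using \<open>P \<noteq> 0\<close> unfolding pnorm_power[symmetric] by (simp add: pnorm_def)
  then have size: "real (kred_fibre_size k P M) = pnorm P ^ k - of_bool (\<not> P dvd M)"
    by (simp add: kred_fibre_size_def of_nat_diff Suc_le_eq)
  show ?thesis
  proof (cases "P dvd M")
    case True
    then have "?I (P * M) = ?I M"
      using monic_irreducible unfolding monic_irreducible_divisors_mult[OF monic_irreducible]
      by (simp add: monic_irreducible_divisors_def insert_absorb)
    then show ?thesis
      using True size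
      by (simp add: phi_eq_prod_monic_irreducible_divisors pnorm_mult power_mult_distrib)
  next
    case False
    then have "P \<notin> ?I M" by (simp add: monic_irreducible_divisors_def)
    then have "phi k (P * M) = pnorm P ^ k * (1 - 1 / pnorm P ^ k) * phi k M"
      by (simp add: phi_eq_prod_monic_irreducible_divisors
          monic_irreducible_divisors_mult[OF monic_irreducible]
          finite_monic_irreducible_divisors[OF M_nonzero] pnorm_mult power_mult_distrib)
    also have "pnorm P ^ k * (1 - 1 / pnorm P ^ k) = pnorm P ^ k - 1"
      using \<open>pnorm P > 0\<close> by (simp add: field_simps)
    finally show ?thesis using False size by simp
  qed
qed

lemma phi_scaleR_sum_kred_residues_mult:
  fixes A N :: "'a::{field,finite} poly" and f :: "'a poly \<Rightarrow> 'b::real_vector"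
  assumes A_monic: "lead_coeff A = 1" and N_nonzero: "N \<noteq> 0"
    and periodic: "\<And>R. f (R mod N ^ k) = f R"
  shows "phi k N *\<^sub>R sum f (kred_residues k (A * N))
       = phi k (A * N) *\<^sub>R sum f (kred_residues k N)"
proof -
  have "A \<noteq> 0" using A_monic by auto
  then show ?thesis using A_monic
  proof (induction A rule: poly_irreducible_induct)
    case (unit U)
    then have "U = 1" by (auto elim!: is_unit_polyE)
    then show ?case by simp
  next
    case (mult P B)
    then have BN_nonzero: "B * N \<noteq> 0" and B_monic: "lead_coeff B = 1"
      using N_nonzero by (auto simp: lead_coeff_mult)
    have "f (R mod (B * N) ^ k) = f R" for R
      using periodic by (metis dvd_triv_right mod_mod_cancel power_mult_distrib)
    from sum_kred_residues_irreducible_mult[of P "B * N" f k, OF mult(1,2) BN_nonzero this]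
    have "phi k N *\<^sub>R sum f (kred_residues k (P * (B * N)))
        = real (kred_fibre_size k P (B * N)) *\<^sub>R phi k N *\<^sub>R sum f (kred_residues k (B * N))"
      by (simp add: mult.commute)
    also have "\<dots> = phi k (P * (B * N)) *\<^sub>R sum f (kred_residues k N)"
      unfolding mult.IH[OF B_monic] by (simp add: phi_irreducible_mult[OF mult(1,2) BN_nonzero])
    finally show ?case by (simp only: mult.assoc)
  qed
qed

section \<open>The character sums\<close>

lemma coeff_mult_degree_add:
  fixes p q :: "'a::comm_semiring_0 poly"
  assumes "degree q \<le> n"
  shows "coeff (p * q) (degree p + n) = lead_coeff p * coeff q n"
proof (cases "degree q = n")
  case True
  then show ?thesis using coeff_mult_degree_sum[of p q] by simp
next
  case False
  then have "degree q < n" using assms by simp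
  moreover from this have "degree (p * q) < degree p + n"
    using degree_mult_le[of p q] by linarith
  ultimately show ?thesis by (simp add: coeff_eq_0)
qed

lemma tcoeff_mult_mult:
  fixes B M X :: "'a::field poly"
  assumes B_nonzero: "B \<noteq> 0" and M_nonzero: "M \<noteq> 0"
  shows "tcoeff (B * M) (B * X) = lead_coeff B * tcoeff M X"
proof (cases "degree M = 0")
  case True
  then have "M dvd X" using M_nonzero is_unit_iff_degree unit_imp_dvd by blast
  then show ?thesis using True by (simp add: tcoeff_def mod_mult_mult1)
next
  case False
  have "degree (X mod M) \<le> degree M - 1"
    using degree_mod_less[OF M_nonzero, of X] False by auto
  from coeff_mult_degree_add[OF this, of B]
  show ?thesis
    using False B_nonzero M_nonzero by (simp add: tcoeff_def mod_mult_mult1 degree_mult_eq)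
qed

lemma E_char_mult_monic:
  assumes "lead_coeff A = 1" "M \<noteq> 0"
  shows "E_char lam (A * G) (A * M) R = E_char lam G M R"
proof -
  have "A \<noteq> 0" using assms(1) by auto
  then show ?thesis
    using tcoeff_mult_mult[of A M "G * R"] assms by (simp add: E_char_def mult.assoc)
qed

lemma phi_eta_mult:
  fixes A N G :: "'a::{field,finite} poly"
  assumes k: "k \<ge> 1" and A_monic: "lead_coeff A = 1" and N_nonzero: "N \<noteq> 0"
  shows "of_real (phi k N) * eta lam k (A ^ k * G) (A * N)
       = of_real (phi k (A * N)) * eta lam k G N"
proof -
  have "A * N \<noteq> 0" using A_monic N_nonzero by auto
  moreover have "E_char lam (A ^ k * G) ((A * N) ^ k) = E_char lam G (N ^ k)"
    using A_monic N_nonzero by (auto simp: power_mult_distrib E_char_mult_monic lead_coeff_power)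
  ultimately show ?thesis
    using phi_scaleR_sum_kred_residues_mult[OF A_monic N_nonzero, of "E_char lam G (N ^ k)" k]
      k N_nonzero
    by (simp add: eta_eq_sum_kred_residues E_char_mod scaleR_conv_of_real)
qed

theorem theorem3p3:
  fixes lam :: "'a::{field,finite} \<Rightarrow> complex"
    and k :: nat and H D1 D2 :: "'a poly"
  assumes lam_nonzero: "\<And>x. lam x \<noteq> 0"
    and lam_hom: "\<And>x y. lam (x + y) = lam x * lam y"
    and lam_nontrivial: "\<exists>x. lam x \<noteq> 1"
    and k: "k \<ge> 1"
    and monic1: "lead_coeff D1 = 1" and monic2: "lead_coeff D2 = 1"
    and dvd1: "D1 ^ k dvd H" and dvd2: "D2 ^ k dvd H"
  shows "of_real (phi k D2) * eta lam k (H div D2 ^ k) D1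
       = of_real (phi k D1) * eta lam k (H div D1 ^ k) D2"
proof -
  obtain N A B where D: "D1 = A * N" "D2 = B * N"
    and monic: "lead_coeff N = 1" "lead_coeff A = 1" "lead_coeff B = 1"
    and comaximal: "comaximal A B"
    by (rule monic_comaximal_cofactors[OF monic1 monic2])
  have nonzero: "N \<noteq> 0" "A \<noteq> 0" "B \<noteq> 0" using monic by auto
  have "(N * A * B) ^ k dvd H"
    using kth_power_lcm[OF comaximal[unfolded comaximal_def], of N] dvd1 dvd2 D
    by (simp add: mult.commute)
  then obtain G where G: "H = (N * A * B) ^ k * G" by blast
  have "H = D2 ^ k * (A ^ k * G)" "H = D1 ^ k * (B ^ k * G)"
    using G D by (simp_all add: power_mult_distrib mult_ac)
  then have H_div: "H div D2 ^ k = A ^ k * G" "H div D1 ^ k = B ^ k * G"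
    using D nonzero by (metis nonzero_mult_div_cancel_left no_zero_divisors power_not_zero)+
  have "of_real (phi k N) * eta lam k (H div D2 ^ k) D1 = of_real (phi k D1) * eta lam k G N"
    and "of_real (phi k N) * eta lam k (H div D1 ^ k) D2 = of_real (phi k D2) * eta lam k G N"
    unfolding H_div unfolding D by (simp_all only: phi_eta_mult[OF k _ nonzero(1)] monic)
  then have "of_real (phi k N) * (of_real (phi k D2) * eta lam k (H div D2 ^ k) D1)
      = of_real (phi k N) * (of_real (phi k D1) * eta lam k (H div D1 ^ k) D2)"
    by (metis mult.left_commute)
  then show ?thesis using phi_nonzero[OF k nonzero(1)] by simp
qed

end
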